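(* Let $G$ be a graph on $n$ vertices and let $k$ be an integer with $1\le k\le n-1$. Suppose that $v_1,\dots,v_s$ ($s\ge 2$) are pendant vertices of $G$ all adjacent to a common vertex $v$ with $d_G(v)\ne n-1$. Let $G^+$ be a graph obtained from $G$ by adding any $t$ edges ($0\le t\le s(s-1)/2$) among $v_1,\dots,v_s$. If $\alpha(F_k(G))=\alpha(G)$, then $\alpha(F_k(G^+))=\alpha(G^+)$.
   Context: $\alpha(G)$ denotes the algebraic connectivity of $G$, i.e. the second smallest eigenvalue of its Laplacian matrix. For a graph $G=(V,E)$ on $n$ vertices and $1\le k\le n-1$, the $k$-token graph $F_k(G)$ has as vertices the $k$-subsets of $V$, two $k$-subsets being adjacent iff their symmetric difference is $\{a,b\}$ with $ab\in E$. A pendant vertex is a vertex of degree 1; $d_G(v)$ is the degree of $v$. *)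

theory Defs
  imports "Jordan_Normal_Form.Char_Poly"
begin

definition simple_graph :: "'a set \<Rightarrow> 'a set set \<Rightarrow> bool" where
  "simple_graph V E \<longleftrightarrow> finite V \<and> (\<forall>e\<in>E. e \<subseteq> V \<and> card e = 2)"

definition vertex_degree :: "'a set set \<Rightarrow> 'a \<Rightarrow> nat" where
  "vertex_degree E v = card {e \<in> E. v \<in> e}"

definition pendant :: "'a set set \<Rightarrow> 'a \<Rightarrow> bool" where
  "pendant E v \<longleftrightarrow> vertex_degree E v = 1"

definition laplacian_mat :: "'a list \<Rightarrow> 'a set set \<Rightarrow> real mat" where
  "laplacian_mat vs E = mat (length vs) (length vs) (\<lambda>(i, j).
     if i = j then real (vertex_degree E (vs ! i))
     else if {vs ! i, vs ! j} \<in> E then -1 else 0)"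

text \<open>Rows and columns are ordered by an arbitrary enumeration of the vertices;
  lemma \<open>char_poly_laplacian_mat_cong\<close> below shows that the choice is immaterial.\<close>

definition laplacian_char_poly :: "'a set \<Rightarrow> 'a set set \<Rightarrow> real poly" where
  "laplacian_char_poly V E =
     char_poly (laplacian_mat (SOME vs. distinct vs \<and> set vs = V) E)"

text \<open>Eigenvalues are listed in increasing order and with multiplicity, so index 1 is the
  second smallest one (and it is 0 for a disconnected graph). The matrix is real symmetric,
  so no eigenvalue is lost by taking real roots. The value is meaningful only for
  graphs with at least two vertices.\<close>

definition algebraic_connectivity :: "'a set \<Rightarrow> 'a set set \<Rightarrow> real" where
  "algebraic_connectivity V E =
     sorted_list_of_multiset (proots (laplacian_char_poly V E)) ! 1"

definition token_verts :: "nat \<Rightarrow> 'a set \<Rightarrow> 'a set set" where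
  "token_verts k V = {A. A \<subseteq> V \<and> card A = k}"

definition token_edges :: "nat \<Rightarrow> 'a set \<Rightarrow> 'a set set \<Rightarrow> 'a set set set" where
  "token_edges k V E = {{A, B} | A B. A \<in> token_verts k V \<and> B \<in> token_verts k V \<and>
     (\<exists>a b. sym_diff A B = {a, b} \<and> {a, b} \<in> E)}"

lemma simple_graph_token:
  assumes "simple_graph V E"
  shows "simple_graph (token_verts k V) (token_edges k V E)"
proof -
  have "A \<noteq> B" if "sym_diff A B \<in> E" for A B
    using that assms by (auto simp: simple_graph_def)
  then show ?thesis
    using assms by (auto simp: simple_graph_def token_verts_def token_edges_def card_2_iff)
qed

lemma char_poly_laplacian_mat_cong:
  assumes vs: "distinct vs" and ws: "distinct ws" and eq: "set vs = set ws"
  shows "char_poly (laplacian_mat vs E) = char_poly (laplacian_mat ws E)"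
proof -
  define n where "n = length vs"
  have n: "length vs = n" "length ws = n"
    using vs ws eq by (metis n_def distinct_card)+
  define f where "f i = (THE j. j < n \<and> ws ! j = vs ! i)" for i
  have "\<exists>!j. j < n \<and> ws ! j = vs ! i" if "i < n" for i
    using that n vs ws eq by (metis in_set_conv_nth nth_eq_iff_index_eq)
  from theI'[OF this] have f: "f i < n" "ws ! f i = vs ! i" if "i < n" for i
    using that by (auto simp: f_def)
  have inj: "f i = f j \<longleftrightarrow> i = j" if "i < n" "j < n" for i j
    using f[of i] f[of j] that vs n by (metis nth_eq_iff_index_eq)
  let ?P = "mat n n (\<lambda>(i, j). if j = f i then 1 else 0) :: real mat"
  let ?Q = "mat n n (\<lambda>(i, j). if i = f j then 1 else 0) :: real mat"
  let ?A = "laplacian_mat vs E" and ?B = "laplacian_mat ws E"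
  have PQ: "?P * ?Q = 1\<^sub>m n"
    using f inj by (intro eq_matI) (auto simp: scalar_prod_def if_distrib[of "\<lambda>x. x * _"] sum.delta cong: if_cong)
  have QP: "?Q * ?P = 1\<^sub>m n"
    by (rule mat_mult_left_right_inverse[OF _ _ PQ]) auto
  have PB: "?P * ?B = mat n n (\<lambda>(i, j). ?B $$ (f i, j))"
    using f n by (intro eq_matI)
      (auto simp: scalar_prod_def laplacian_mat_def if_distrib[of "\<lambda>x. x * _"] sum.delta cong: if_cong)
  have "?P * ?B * ?Q = mat n n (\<lambda>(i, j). ?B $$ (f i, f j))"
    unfolding PB using f n by (intro eq_matI)
      (auto simp: scalar_prod_def if_distrib[of "\<lambda>x. _ * x"] sum.delta cong: if_cong)
  also have "\<dots> = ?A"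
    using f n inj by (intro eq_matI) (auto simp: laplacian_mat_def)
  finally have "?A = ?P * ?B * ?Q" by simp
  then have "similar_mat ?A ?B"
    by (intro similar_matI[OF _ PQ QP]) (auto simp: laplacian_mat_def n)
  then show ?thesis by (rule char_poly_similar)
qed

lemma laplacian_char_poly_eq:
  assumes "distinct vs" "set vs = V"
  shows "laplacian_char_poly V E = char_poly (laplacian_mat vs E)"
proof -
  have "distinct (SOME vs. distinct vs \<and> set vs = V) \<and> set (SOME vs. distinct vs \<and> set vs = V) = V"
    using assms by (intro someI[of "\<lambda>vs. distinct vs \<and> set vs = V"]) auto
  then show ?thesis
    unfolding laplacian_char_poly_def using assms by (intro char_poly_laplacian_mat_cong) auto
qed

end

theory Submission
  imports Defs
begin

text \<open>
  The all-ones vector extends to an orthogonal eigenbasis of the Laplacian, so the algebraic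
  connectivity is the minimum of the Rayleigh quotient over functions with zero sum; in
  particular it can only grow when edges are added. If \<open>f\<close> is a Laplacian eigenfunction of
  \<open>G\<close>, then \<open>A \<mapsto> sum f A\<close> is one of \<open>F\<^sub>k(G)\<close> for the same eigenvalue; hence
  \<open>\<alpha>(F\<^sub>k(G)) \<le> \<alpha>(G)\<close> for every graph. Since \<open>v\<close> is a cut vertex that is not adjacent to all
  other vertices, \<open>\<alpha>(G) < 1\<close>. The eigenvalue equation at a pendant neighbour \<open>u\<close> of \<open>v\<close> reads
  \<open>(1 - \<alpha>(G)) f u = f v\<close>, so an eigenfunction for \<open>\<alpha>(G)\<close> takes the same value at all these
  \<open>u\<close>, and edges among them do not change its Rayleigh quotient. Therefore
  \<open>\<alpha>(G\<^sup>+) \<le> \<alpha>(G) = \<alpha>(F\<^sub>k(G)) \<le> \<alpha>(F\<^sub>k(G\<^sup>+)) \<le> \<alpha>(G\<^sup>+)\<close>.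
\<close>

section \<open>Orthogonal diagonalization of real symmetric matrices\<close>

text \<open>For \<open>w = 0\<close> the reflection is the identity matrix, since \<open>2 / 0 = 0\<close>.\<close>

definition householder_mat :: "real vec \<Rightarrow> real mat" where
  "householder_mat w = mat (dim_vec w) (dim_vec w)
     (\<lambda>(i, j). (if i = j then 1 else 0) - 2 / (w \<bullet> w) * w $ i * w $ j)"

lemma householder_mat_carrier: "w \<in> carrier_vec n \<Longrightarrow> householder_mat w \<in> carrier_mat n n"
  by (auto simp: householder_mat_def)

lemma transpose_householder_mat: "(householder_mat w)\<^sup>T = householder_mat w"
  by (intro eq_matI) (auto simp: householder_mat_def)

lemma householder_mat_involution:
  assumes w: "w \<in> carrier_vec n"
  shows "householder_mat w * householder_mat w = 1\<^sub>m n"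
proof (intro eq_matI)
  define c where "c = 2 / (w \<bullet> w)"
  have c_norm: "c * (c * (w \<bullet> w)) = 2 * c" by (simp add: c_def)
  fix i j assume "i < dim_row (1\<^sub>m n :: real mat)" "j < dim_col (1\<^sub>m n :: real mat)"
  then have i: "i < n" and j: "j < n" by auto
  have "(householder_mat w * householder_mat w) $$ (i, j)
      = (\<Sum>k<n. ((if i = k then 1 else 0) - c * w $ i * w $ k)
                * ((if k = j then 1 else 0) - c * w $ k * w $ j))"
    using w i j by (simp add: householder_mat_def scalar_prod_def c_def lessThan_atLeast0)
  also have "\<dots> = (\<Sum>k<n. (if k = i then (if i = j then 1 else 0) - c * w $ i * w $ j else 0)
      - (if k = j then c * w $ i * w $ j else 0) + c * c * w $ i * w $ j * (w $ k * w $ k))"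
    by (intro sum.cong refl) (auto simp: algebra_simps)
  also have "\<dots> = (if i = j then 1 else 0) - 2 * c * w $ i * w $ j
      + c * (c * (w \<bullet> w)) * w $ i * w $ j"
    using w i j
    by (simp add: sum.distrib sum_subtractf scalar_prod_def lessThan_atLeast0
        flip: sum_distrib_left)
  also have "\<dots> = 1\<^sub>m n $$ (i, j)"
    using i j by (simp add: c_norm)
  finally show "(householder_mat w * householder_mat w) $$ (i, j) = 1\<^sub>m n $$ (i, j)" .
qed (use w in \<open>auto simp: householder_mat_def\<close>)

lemma col_householder_mat_diff_unit_vec:
  assumes v: "v \<in> carrier_vec n" "v \<bullet> v = 1"
  shows "col (householder_mat (v - unit_vec n 0)) 0 = v"
proof -
  define w where "w = v - unit_vec n 0"
  have n: "0 < n" using v by (cases n) (auto simp: scalar_prod_def)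
  have w: "w \<in> carrier_vec n" using v by (simp add: w_def)
  have norm_w: "w \<bullet> w = 2 * (1 - v $ 0)"
    using v n unfolding w_def
    by (simp add: minus_scalar_prod_distrib[of _ n] scalar_prod_minus_distrib[of _ n])
  have "(if i = 0 then 1 else 0) - 2 / (w \<bullet> w) * w $ i * w $ 0 = v $ i" if i: "i < n" for i
  proof (cases "w = 0\<^sub>v n")
    case True
    then have "w $ i = 0" using i by simp
    then show ?thesis using i n v by (auto simp: w_def)
  next
    case False
    then have "w \<bullet> w \<noteq> 0" using conjugate_square_eq_0_vec[OF w] by simp
    then show ?thesis using i n v by (auto simp: norm_w) (auto simp: w_def field_simps)
  qed
  then show ?thesis
    using v(1) w n unfolding w_def[symmetric]
    by (intro eq_vecI) (auto simp: householder_mat_def)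
qed

lemma real_eigenvector_normalize:
  fixes A :: "real mat"
  assumes A: "A \<in> carrier_mat n n" and u: "u \<in> carrier_vec n" "u \<noteq> 0\<^sub>v n" "A *\<^sub>v u = e \<cdot>\<^sub>v u"
  obtains c where "c \<noteq> 0" "(c \<cdot>\<^sub>v u) \<bullet> (c \<cdot>\<^sub>v u) = 1" "A *\<^sub>v (c \<cdot>\<^sub>v u) = e \<cdot>\<^sub>v (c \<cdot>\<^sub>v u)"
proof -
  have "u \<bullet> u > 0" using conjugate_square_greater_0_vec[OF u(1)] u(2) by simp
  then show ?thesis
    using u A by (intro that[of "1 / sqrt (u \<bullet> u)"])
      (auto simp: mult_mat_vec smult_smult_assoc mult.commute)
qed

lemma char_poly_four_block_scalar:
  fixes B :: "'a::idom mat"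
  assumes "B \<in> carrier_mat m m"
  shows "char_poly (four_block_mat (mat 1 1 (\<lambda>_. e)) (0\<^sub>m 1 m) (0\<^sub>m m 1) B)
    = [:- e, 1:] * char_poly B"
proof -
  have "char_poly (mat 1 1 (\<lambda>_. e)) = [:- e, 1:]"
    by (simp add: char_poly_defs det_def sign_def)
  then show ?thesis
    using char_poly_four_block_zeros_col[OF _ _ assms] by simp
qed

lemma symmetric_mat_eq_four_block_scalar:
  assumes C: "C \<in> carrier_mat (Suc m) (Suc m)" and sym: "C\<^sup>T = C"
    and col_0: "\<And>i. i < Suc m \<Longrightarrow> C $$ (i, 0) = (if i = 0 then e else 0)"
  obtains B where "B \<in> carrier_mat m m" "B\<^sup>T = B"
    "C = four_block_mat (mat 1 1 (\<lambda>_. e)) (0\<^sub>m 1 m) (0\<^sub>m m 1) B"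
proof -
  have entry_sym: "C $$ (i, j) = C $$ (j, i)" if "i < Suc m" "j < Suc m" for i j
    using arg_cong[OF sym, of "\<lambda>M. M $$ (i, j)"] C that by simp
  define B where "B = mat m m (\<lambda>(i, j). C $$ (Suc i, Suc j))"
  have "B \<in> carrier_mat m m" by (simp add: B_def)
  moreover have "B\<^sup>T = B"
    by (intro eq_matI) (auto simp: B_def entry_sym)
  moreover have "C = four_block_mat (mat 1 1 (\<lambda>_. e)) (0\<^sub>m 1 m) (0\<^sub>m m 1) B"
    using C col_0 entry_sym[of 0] by (intro eq_matI) (auto simp: B_def)
  ultimately show ?thesis using that by blast
qed

lemma symmetric_mat_deflation:
  fixes A :: "real mat"
  assumes A: "A \<in> carrier_mat (Suc m) (Suc m)" and sym: "A\<^sup>T = A"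
    and v: "v \<in> carrier_vec (Suc m)" "v \<bullet> v = 1" "A *\<^sub>v v = e \<cdot>\<^sub>v v"
  obtains B W where "B \<in> carrier_mat m m" "B\<^sup>T = B" "col W 0 = v"
    "similar_mat_wit A (four_block_mat (mat 1 1 (\<lambda>_. e)) (0\<^sub>m 1 m) (0\<^sub>m m 1) B) W W\<^sup>T"
proof -
  define W where "W = householder_mat (v - unit_vec (Suc m) 0)"
  have W: "W \<in> carrier_mat (Suc m) (Suc m)"
    using v by (auto simp: W_def intro: householder_mat_carrier)
  have W_sym: "W\<^sup>T = W" by (simp add: W_def transpose_householder_mat)
  have W_inv: "W * W = 1\<^sub>m (Suc m)"
    using v by (auto simp: W_def intro: householder_mat_involution)
  have col_W: "col W 0 = v"
    using v by (simp add: W_def col_householder_mat_diff_unit_vec)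
  note assoc = assoc_mult_mat[of _ "Suc m" "Suc m" _ "Suc m" _ "Suc m"]
  define C where "C = W * A * W"
  have C: "C \<in> carrier_mat (Suc m) (Suc m)" using W A by (simp add: C_def)
  have C_sym: "C\<^sup>T = C"
    using W A
    by (simp add: C_def transpose_mult[of _ "Suc m" "Suc m" _ "Suc m"] sym W_sym assoc)
  have C_col_0: "C $$ (i, 0) = (if i = 0 then e else 0)" if i: "i < Suc m" for i
  proof -
    have "C $$ (i, 0) = row W i \<bullet> (A *\<^sub>v v)"
      using W A i by (simp add: C_def assoc col_W[symmetric] mult_mat_vec_def)
    also have "\<dots> = e * (W * W) $$ (i, 0)"
      using W i v(1) by (simp add: v(3) col_W)
    finally show ?thesis using i by (simp add: W_inv)
  qed
  have "similar_mat_wit A C W W\<^sup>T"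
    unfolding W_sym
    by (rule similar_mat_wit_sym[OF similar_mat_witI[OF W_inv W_inv C_def C A W W]])
  then show ?thesis
    using symmetric_mat_eq_four_block_scalar[OF C C_sym C_col_0] that col_W by metis
qed

lemma similar_mat_wit_transpose_four_block:
  fixes R :: "'a::comm_ring_1 mat"
  assumes a: "a \<in> carrier_mat 1 1" and B: "B \<in> carrier_mat m m"
    and R: "similar_mat_wit B D R R\<^sup>T"
  defines "Q \<equiv> four_block_mat (1\<^sub>m 1) (0\<^sub>m 1 m) (0\<^sub>m m 1) R"
  shows "similar_mat_wit (four_block_mat a (0\<^sub>m 1 m) (0\<^sub>m m 1) B)
    (four_block_mat a (0\<^sub>m 1 m) (0\<^sub>m m 1) D) Q Q\<^sup>T"
proof -
  have Rc: "R \<in> carrier_mat m m"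
    using similar_mat_witD2[OF B R] by simp
  have "Q\<^sup>T = four_block_mat (1\<^sub>m 1) (0\<^sub>m 1 m) (0\<^sub>m m 1) R\<^sup>T"
    using Rc unfolding Q_def by (subst transpose_four_block_mat[of _ 1 1 _ m _ m]) auto
  moreover have "similar_mat_wit (four_block_mat a (0\<^sub>m 1 m) (0\<^sub>m m 1) B)
    (four_block_mat a (0\<^sub>m 1 m) (0\<^sub>m m 1) D) Q
    (four_block_mat (1\<^sub>m 1) (0\<^sub>m 1 m) (0\<^sub>m m 1) R\<^sup>T)"
    unfolding Q_def
    by (rule similar_mat_wit_four_block[OF similar_mat_wit_refl[OF a] R _ _ a B]) (use Rc in auto)
  ultimately show ?thesis by simp
qed

lemma orthogonal_diagonalization_of_deflated:
  fixes A :: "'a::comm_ring_1 mat"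
  assumes A: "A \<in> carrier_mat (Suc m) (Suc m)" and B: "B \<in> carrier_mat m m"
    and AB: "similar_mat_wit A (four_block_mat (mat 1 1 (\<lambda>_. e)) (0\<^sub>m 1 m) (0\<^sub>m m 1) B) W W\<^sup>T"
    and BD: "similar_mat_wit B (mat_diag m ((!) es)) R R\<^sup>T"
  shows "\<exists>P. similar_mat_wit A (mat_diag (Suc m) ((!) (e # es))) P P\<^sup>T \<and> col P 0 = col W 0"
proof -
  define Q where "Q = four_block_mat (1\<^sub>m 1) (0\<^sub>m 1 m) (0\<^sub>m m 1) R"
  have W: "W \<in> carrier_mat (Suc m) (Suc m)" and R: "R \<in> carrier_mat m m"
    using similar_mat_witD2[OF A AB] similar_mat_witD2[OF B BD] by auto
  have Q: "Q \<in> carrier_mat (Suc m) (Suc m)"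
    using four_block_carrier_mat[OF one_carrier_mat[of 1] R] by (simp add: Q_def)
  have "four_block_mat (mat 1 1 (\<lambda>_. e)) (0\<^sub>m 1 m) (0\<^sub>m m 1) (mat_diag m ((!) es))
      = mat_diag (Suc m) ((!) (e # es))"
    by (intro eq_matI) (auto simp: mat_diag_def nth_Cons')
  then have "similar_mat_wit A (mat_diag (Suc m) ((!) (e # es))) (W * Q) (Q\<^sup>T * W\<^sup>T)"
    using similar_mat_wit_trans[OF AB similar_mat_wit_transpose_four_block[OF _ B BD]]
    by (simp add: Q_def)
  moreover have "Q\<^sup>T * W\<^sup>T = (W * Q)\<^sup>T"
    using W Q by (simp add: transpose_mult)
  moreover have "col (W * Q) 0 = col W 0"
  proof -
    have "col Q 0 = unit_vec (Suc m) 0"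
      using R by (intro eq_vecI) (auto simp: Q_def)
    then have "col (W * Q) 0 = W *\<^sub>v unit_vec (Suc m) 0"
      by (simp only: col_mult2[OF W Q zero_less_Suc])
    also have "\<dots> = col W 0"
      using W by (intro eq_vecI) auto
    finally show ?thesis .
  qed
  ultimately show ?thesis by metis
qed

theorem real_symmetric_orthogonal_diagonalization:
  fixes A :: "real mat"
  assumes "A \<in> carrier_mat n n" and "A\<^sup>T = A"
    and "char_poly A = (\<Prod>x\<leftarrow>e # es. [:- x, 1:])"
    and "v \<in> carrier_vec n" "v \<bullet> v = 1" "A *\<^sub>v v = e \<cdot>\<^sub>v v"
  shows "\<exists>P. similar_mat_wit A (mat_diag n ((!) (e # es))) P P\<^sup>T \<and> col P 0 = v"
  using assms
proof (induction n arbitrary: A e es v)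
  case 0
  then show ?case by (simp add: scalar_prod_def)
next
  case (Suc m)
  obtain B W where B: "B \<in> carrier_mat m m" and B_sym: "B\<^sup>T = B" and col_W: "col W 0 = v"
    and AB: "similar_mat_wit A (four_block_mat (mat 1 1 (\<lambda>_. e)) (0\<^sub>m 1 m) (0\<^sub>m m 1) B) W W\<^sup>T"
    using symmetric_mat_deflation[OF Suc.prems(1,2,4-6)] by blast
  have "char_poly A = [:- e, 1:] * char_poly B"
    unfolding char_poly_four_block_scalar[OF B, symmetric]
    using AB by (intro char_poly_similar) (auto simp: similar_mat_def)
  then have "[:- e, 1:] * char_poly B = [:- e, 1:] * (\<Prod>x\<leftarrow>es. [:- x, 1:])"
    using Suc.prems(3) by simp
  then have B_char_poly: "char_poly B = (\<Prod>x\<leftarrow>es. [:- x, 1:])"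
    by (metis mult_cancel_left pCons_eq_0_iff zero_neq_one)
  have "\<exists>R. similar_mat_wit B (mat_diag m ((!) es)) R R\<^sup>T"
  proof (cases es)
    case Nil
    then have "m = 0" using B B_char_poly degree_monic_char_poly[of B m] by simp
    then have "similar_mat_wit B (mat_diag m ((!) es)) (1\<^sub>m 0) (1\<^sub>m 0)\<^sup>T"
      using B by (intro similar_mat_witI[of _ _ 0]) (auto intro!: eq_matI)
    then show ?thesis by blast
  next
    case (Cons e' es')
    then have "eigenvalue B e'"
      by (simp add: eigenvalue_root_char_poly[OF B] B_char_poly)
    then obtain u where u: "u \<in> carrier_vec m" "u \<noteq> 0\<^sub>v m" "B *\<^sub>v u = e' \<cdot>\<^sub>v u"
      using B unfolding eigenvalue_def eigenvector_def by auto
    then obtain c where "(c \<cdot>\<^sub>v u) \<bullet> (c \<cdot>\<^sub>v u) = 1" "B *\<^sub>v (c \<cdot>\<^sub>v u) = e' \<cdot>\<^sub>v (c \<cdot>\<^sub>v u)"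
      using real_eigenvector_normalize[OF B] by blast
    then show ?thesis
      using Suc.IH[OF B B_sym, of e' es' "c \<cdot>\<^sub>v u"] B_char_poly Cons u(1) by auto
  qed
  then show ?case
    using orthogonal_diagonalization_of_deflated[OF Suc.prems(1) B AB] col_W by blast
qed

section \<open>Reality of the spectrum\<close>

lemma eigenvalue_hermitian_real:
  fixes A :: "complex mat"
  assumes A: "A \<in> carrier_mat n n" and hermitian: "A\<^sup>T = map_mat cnj A" and "eigenvalue A z"
  shows "z \<in> \<real>"
proof -
  obtain v where v: "v \<in> carrier_vec n" "v \<noteq> 0\<^sub>v n" "A *\<^sub>v v = z \<cdot>\<^sub>v v"
    using A \<open>eigenvalue A z\<close> unfolding eigenvalue_def eigenvector_def by auto
  have conjugate_mult: "map_mat cnj A *\<^sub>v conjugate v = conjugate (A *\<^sub>v v)"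
    using A v(1) by (intro eq_vecI) (auto simp: scalar_prod_def sum_conjugate)
  have "z * (v \<bullet>c v) = (A *\<^sub>v v) \<bullet>c v"
    using v by simp
  also have "\<dots> = v \<bullet> (A\<^sup>T *\<^sub>v conjugate v)"
    using transpose_vec_mult_scalar[of "A\<^sup>T" n n "conjugate v" v] A v(1) by simp
  also have "\<dots> = v \<bullet>c (z \<cdot>\<^sub>v v)"
    by (simp add: hermitian conjugate_mult v(3))
  also have "\<dots> = cnj z * (v \<bullet>c v)"
    using v(1) by (simp add: conjugate_smult_vec)
  finally have "z = cnj z"
    using conjugate_square_eq_0_vec[OF v(1)] v(2) by simp
  then show ?thesis by (simp add: Reals_cnj_iff)
qed

lemma real_symmetric_char_poly_splits:
  fixes A :: "real mat"
  assumes A: "A \<in> carrier_mat n n" and sym: "A\<^sup>T = A"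
  shows "\<exists>es. char_poly A = (\<Prod>x\<leftarrow>es. [:- x, 1:]) \<and> length es = n \<and> sorted es"
proof -
  interpret p: map_poly_inj_comm_ring_hom complex_of_real ..
  define A\<^sub>c where "A\<^sub>c = map_mat complex_of_real A"
  have A\<^sub>c: "A\<^sub>c \<in> carrier_mat n n" using A by (simp add: A\<^sub>c_def)
  have A\<^sub>c_hermitian: "A\<^sub>c\<^sup>T = map_mat cnj A\<^sub>c"
  proof -
    have "A\<^sub>c\<^sup>T = map_mat complex_of_real A\<^sup>T" by (intro eq_matI) (auto simp: A\<^sub>c_def)
    then show ?thesis unfolding sym by (auto simp: A\<^sub>c_def)
  qed
  obtain zs where zs: "char_poly A\<^sub>c = (\<Prod>z\<leftarrow>zs. [:- z, 1:])" "length zs = n"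
    using char_poly_factorized[OF A\<^sub>c] by blast
  have "z \<in> \<real>" if "z \<in> set zs" for z
  proof -
    have "poly (char_poly A\<^sub>c) z = 0"
      using that by (auto simp: zs(1) poly_prod_list o_def prod_list_zero_iff)
    then show ?thesis
      using eigenvalue_hermitian_real[OF A\<^sub>c A\<^sub>c_hermitian] eigenvalue_root_char_poly[OF A\<^sub>c]
      by blast
  qed
  then have zs_real: "map (\<lambda>z. complex_of_real (Re z)) zs = zs"
    by (intro map_idI) simp
  define es where "es = sort (map Re zs)"
  have "map_poly complex_of_real (char_poly A) = char_poly A\<^sub>c"
    unfolding A\<^sub>c_def by (rule of_real_hom.char_poly_hom[OF A, symmetric])
  also have "\<dots> = (\<Prod>z\<leftarrow>map (\<lambda>z. complex_of_real (Re z)) zs. [:- z, 1:])"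
    by (simp only: zs_real zs(1))
  also have "\<dots> = map_poly complex_of_real (\<Prod>x\<leftarrow>map Re zs. [:- x, 1:])"
    by (simp add: p.hom_prod_list o_def)
  finally have "char_poly A = (\<Prod>x\<leftarrow>map Re zs. [:- x, 1:])"
    by simp
  also have "\<dots> = (\<Prod>x\<leftarrow>es. [:- x, 1:])"
    by (simp add: es_def multiset.map_comp flip: prod_mset_prod_list)
  finally have "char_poly A = (\<Prod>x\<leftarrow>es. [:- x, 1:])" .
  moreover have "length es = n" and "sorted es"
    by (simp_all add: es_def zs(2))
  ultimately show ?thesis by blast
qed

section \<open>Rayleigh quotients\<close>

lemma eigenvector_of_diagonalization:
  fixes A :: "'a::comm_ring_1 mat"
  assumes A: "A \<in> carrier_mat n n" and diag: "similar_mat_wit A (mat_diag n d) P Q" and i: "i < n"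
  shows "A *\<^sub>v col P i = d i \<cdot>\<^sub>v col P i"
proof -
  have P: "P \<in> carrier_mat n n" and Q: "Q \<in> carrier_mat n n" and "Q * P = 1\<^sub>m n"
    and A_eq: "A = P * mat_diag n d * Q"
    using similar_mat_witD2[OF A diag] by blast+
  have "A * P = P * mat_diag n d * (Q * P)"
    unfolding A_eq by (rule assoc_mult_mat[of _ n n _ n _ n]) (use P Q in auto)
  then have "A * P = P * mat_diag n d"
    using P \<open>Q * P = 1\<^sub>m n\<close> by (simp add: right_mult_one_mat[of _ n n])
  then have "A * P = mat n n (\<lambda>(i, j). P $$ (i, j) * d j)"
    using mat_diag_mult_right[OF P] by simp
  then have "A *\<^sub>v col P i = col (mat n n (\<lambda>(i, j). P $$ (i, j) * d j)) i"
    using col_mult2[OF A P i] by simp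
  also have "\<dots> = d i \<cdot>\<^sub>v col P i"
    using P i by (intro eq_vecI) (auto simp: mult.commute)
  finally show ?thesis .
qed

lemma parseval_cols:
  fixes P :: "'a::comm_ring_1 mat"
  assumes P: "P \<in> carrier_mat n n" and PPT: "P * P\<^sup>T = 1\<^sub>m n"
    and x: "x \<in> carrier_vec n" and y: "y \<in> carrier_vec n"
  shows "x \<bullet> y = (\<Sum>i<n. (col P i \<bullet> x) * (col P i \<bullet> y))"
proof -
  have PT: "P\<^sup>T \<in> carrier_mat n n" using P by simp
  have "x \<bullet> y = x \<bullet> (P *\<^sub>v (P\<^sup>T *\<^sub>v y))"
    using P PT PPT y by (simp flip: assoc_mult_mat_vec[of _ n n _ n])
  also have "\<dots> = (P\<^sup>T *\<^sub>v x) \<bullet> (P\<^sup>T *\<^sub>v y)"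
    using transpose_vec_mult_scalar[OF P, of "P\<^sup>T *\<^sub>v y" x] x y PT by simp
  also have "\<dots> = (\<Sum>i<n. (col P i \<bullet> x) * (col P i \<bullet> y))"
    using P by (simp add: scalar_prod_def[of "P\<^sup>T *\<^sub>v x"] lessThan_atLeast0)
  finally show ?thesis .
qed

lemma quadratic_form_diagonalization:
  fixes A :: "'a::comm_ring_1 mat"
  assumes A: "A \<in> carrier_mat n n" and diag: "similar_mat_wit A (mat_diag n d) P P\<^sup>T"
    and x: "x \<in> carrier_vec n"
  shows "x \<bullet> (A *\<^sub>v x) = (\<Sum>i<n. d i * (col P i \<bullet> x)\<^sup>2)"
proof -
  have P: "P \<in> carrier_mat n n" and A_eq: "A = P * mat_diag n d * P\<^sup>T"
    using similar_mat_witD2[OF A diag] by blast+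
  have diag_vec: "mat_diag n d *\<^sub>v y = vec n (\<lambda>i. d i * y $ i)" if "y \<in> carrier_vec n" for y
    using that
    by (intro eq_vecI)
      (auto simp: mat_diag_def scalar_prod_def if_distrib[of "\<lambda>a. a * _"] cong: if_cong)
  have "x \<bullet> (A *\<^sub>v x) = x \<bullet> (P *\<^sub>v (mat_diag n d *\<^sub>v (P\<^sup>T *\<^sub>v x)))"
    using P x by (simp add: A_eq assoc_mult_mat_vec[of _ n n _ n])
  also have "\<dots> = (P\<^sup>T *\<^sub>v x) \<bullet> (mat_diag n d *\<^sub>v (P\<^sup>T *\<^sub>v x))"
    using P x
    by (intro transpose_vec_mult_scalar[symmetric]) (auto intro!: mult_mat_vec_carrier[of _ n n])
  also have "\<dots> = (\<Sum>i<n. d i * (col P i \<bullet> x)\<^sup>2)"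
    using P x
    by (simp add: diag_vec scalar_prod_def[of "P\<^sup>T *\<^sub>v x"] lessThan_atLeast0
        power2_eq_square mult_ac)
  finally show ?thesis .
qed

lemma orthonormal_cols:
  fixes P :: "'a::comm_ring_1 mat"
  assumes "P \<in> carrier_mat n n" and "P\<^sup>T * P = 1\<^sub>m n" and "i < n" "j < n"
  shows "col P i \<bullet> col P j = (if i = j then 1 else 0)"
proof -
  have "col P i \<bullet> col P j = (P\<^sup>T * P) $$ (i, j)" using assms(1,3,4) by simp
  then show ?thesis using assms(3,4) by (simp only: assms(2)) simp
qed

lemma real_symmetric_diagonalization_extending_eigenvector:
  fixes A :: "real mat"
  assumes A: "A \<in> carrier_mat n n" and sym: "A\<^sup>T = A"
    and u: "u \<in> carrier_vec n" "u \<noteq> 0\<^sub>v n" "A *\<^sub>v u = e \<cdot>\<^sub>v u"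
    and char_poly: "char_poly A = (\<Prod>x\<leftarrow>e # es. [:- x, 1:])"
  obtains P c where "similar_mat_wit A (mat_diag n ((!) (e # es))) P P\<^sup>T"
    "c \<noteq> 0" "col P 0 = c \<cdot>\<^sub>v u"
proof -
  obtain c where normalized: "c \<noteq> 0" "(c \<cdot>\<^sub>v u) \<bullet> (c \<cdot>\<^sub>v u) = 1"
    "A *\<^sub>v (c \<cdot>\<^sub>v u) = e \<cdot>\<^sub>v (c \<cdot>\<^sub>v u)"
    using real_eigenvector_normalize[OF A u] by blast
  then show ?thesis
    using real_symmetric_orthogonal_diagonalization[OF A sym char_poly _ normalized(2,3)] u(1) that
    by auto
qed

lemma symmetric_mat_orthogonal_eigenvector:
  fixes A :: "real mat"
  assumes A: "A \<in> carrier_mat n n" and sym: "A\<^sup>T = A"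
    and u: "u \<in> carrier_vec n" "u \<noteq> 0\<^sub>v n" "A *\<^sub>v u = e \<cdot>\<^sub>v u"
    and char_poly: "char_poly A = (\<Prod>x\<leftarrow>e # \<mu> # es. [:- x, 1:])"
  obtains x where "x \<in> carrier_vec n" "x \<noteq> 0\<^sub>v n" "x \<bullet> u = 0" "A *\<^sub>v x = \<mu> \<cdot>\<^sub>v x"
proof -
  have n: "1 < n"
    using degree_monic_char_poly[OF A] degree_linear_factors[of uminus "e # \<mu> # es"]
    by (simp add: char_poly)
  obtain P c where diag: "similar_mat_wit A (mat_diag n ((!) (e # \<mu> # es))) P P\<^sup>T"
    and c_nonzero: "c \<noteq> 0" and col_0: "col P 0 = c \<cdot>\<^sub>v u"
    using real_symmetric_diagonalization_extending_eigenvector[OF A sym u char_poly] .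
  have P: "P \<in> carrier_mat n n" and PTP: "P\<^sup>T * P = 1\<^sub>m n"
    using similar_mat_witD2[OF A diag] by blast+
  show ?thesis
  proof
    show "col P 1 \<in> carrier_vec n" using P by auto
    show "col P 1 \<noteq> 0\<^sub>v n"
      using orthonormal_cols[OF P PTP, of 1 1] n by auto
    show "col P 1 \<bullet> u = 0"
      using orthonormal_cols[OF P PTP, of 1 0] c_nonzero u(1) P n by (simp add: col_0)
    show "A *\<^sub>v col P 1 = \<mu> \<cdot>\<^sub>v col P 1"
      using eigenvector_of_diagonalization[OF A diag n] by simp
  qed
qed

lemma symmetric_mat_Rayleigh_le:
  fixes A :: "real mat"
  assumes A: "A \<in> carrier_mat n n" and sym: "A\<^sup>T = A"
    and u: "u \<in> carrier_vec n" "u \<noteq> 0\<^sub>v n" "A *\<^sub>v u = e \<cdot>\<^sub>v u"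
    and char_poly: "char_poly A = (\<Prod>x\<leftarrow>e # es. [:- x, 1:])" and \<mu>: "\<forall>x\<in>set es. \<mu> \<le> x"
    and x: "x \<in> carrier_vec n" "x \<bullet> u = 0"
  shows "\<mu> * (x \<bullet> x) \<le> x \<bullet> (A *\<^sub>v x)"
proof -
  define d where "d = (!) (e # es)"
  have n: "n = Suc (length es)"
    using degree_monic_char_poly[OF A] degree_linear_factors[of uminus "e # es"]
    by (simp add: char_poly)
  obtain P c where diag: "similar_mat_wit A (mat_diag n d) P P\<^sup>T" and col_0: "col P 0 = c \<cdot>\<^sub>v u"
    using real_symmetric_diagonalization_extending_eigenvector[OF A sym u char_poly]
    unfolding d_def by blast
  have P: "P \<in> carrier_mat n n" and PPT: "P * P\<^sup>T = 1\<^sub>m n"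
    using similar_mat_witD2[OF A diag] by blast+
  have "\<mu> * (col P i \<bullet> x)\<^sup>2 \<le> d i * (col P i \<bullet> x)\<^sup>2" if "i < n" for i
  proof (cases i)
    case 0
    then show ?thesis using u(1) x by (simp add: col_0 comm_scalar_prod[of u n])
  next
    case (Suc j)
    then show ?thesis using \<mu> that n by (intro mult_right_mono) (simp_all add: d_def)
  qed
  moreover have "\<mu> * (x \<bullet> x) = (\<Sum>i<n. \<mu> * (col P i \<bullet> x)\<^sup>2)"
    using parseval_cols[OF P PPT x(1) x(1)] by (simp add: sum_distrib_left power2_eq_square)
  moreover have "x \<bullet> (A *\<^sub>v x) = (\<Sum>i<n. d i * (col P i \<bullet> x)\<^sup>2)"
    by (rule quadratic_form_diagonalization[OF A diag x(1)])
  ultimately show ?thesis by (auto intro: sum_mono)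
qed

section \<open>Graph Laplacians and Dirichlet energy\<close>

definition neighbours :: "'a set \<Rightarrow> 'a set set \<Rightarrow> 'a \<Rightarrow> 'a set" where
  "neighbours V E a = {b \<in> V. {a, b} \<in> E}"

definition graph_laplacian :: "'a set \<Rightarrow> 'a set set \<Rightarrow> ('a \<Rightarrow> real) \<Rightarrow> 'a \<Rightarrow> real" where
  "graph_laplacian V E f a = (\<Sum>b\<in>neighbours V E a. f a - f b)"

text \<open>The sum visits every edge in both directions, hence the factor \<open>1 / 2\<close>.\<close>

definition dirichlet_energy :: "'a set \<Rightarrow> 'a set set \<Rightarrow> ('a \<Rightarrow> real) \<Rightarrow> real" where
  "dirichlet_energy V E f = (\<Sum>a\<in>V. \<Sum>b\<in>neighbours V E a. (f a - f b)\<^sup>2) / 2"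

definition laplacian_eigenfunction :: "'a set \<Rightarrow> 'a set set \<Rightarrow> real \<Rightarrow> ('a \<Rightarrow> real) \<Rightarrow> bool" where
  "laplacian_eigenfunction V E \<mu> f \<longleftrightarrow>
     (\<exists>a\<in>V. f a \<noteq> 0) \<and> (\<forall>a\<in>V. graph_laplacian V E f a = \<mu> * f a)"

lemma simple_graph_finite: "simple_graph V E \<Longrightarrow> finite V"
  by (simp add: simple_graph_def)

lemma simple_graph_no_loop: "simple_graph V E \<Longrightarrow> {a, b} \<in> E \<Longrightarrow> a \<noteq> b"
  by (auto simp: simple_graph_def)

lemma finite_neighbours: "finite V \<Longrightarrow> finite (neighbours V E a)"
  by (simp add: neighbours_def)

lemma vertex_degree_eq_card_neighbours:
  assumes G: "simple_graph V E"
  shows "vertex_degree E a = card (neighbours V E a)"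
proof -
  have "{e \<in> E. a \<in> e} = (\<lambda>b. {a, b}) ` neighbours V E a"
    using G by (fastforce simp: simple_graph_def neighbours_def card_2_iff insert_commute)
  moreover have "inj_on (\<lambda>b. {a, b}) (neighbours V E a)"
    by (auto simp: inj_on_def doubleton_eq_iff)
  ultimately show ?thesis by (simp add: vertex_degree_def card_image)
qed

lemma sum_neighbours_swap:
  assumes "finite V"
  shows "(\<Sum>a\<in>V. \<Sum>b\<in>neighbours V E a. h a b) = (\<Sum>a\<in>V. \<Sum>b\<in>neighbours V E a. h b a)"
  using sum.swap_restrict[OF assms assms, of h "\<lambda>a b. {a, b} \<in> E"]
  by (simp add: neighbours_def insert_commute)

lemma sum_graph_laplacian:
  assumes "finite V"
  shows "sum (graph_laplacian V E f) V = 0"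
  using sum_neighbours_swap[OF assms, of "\<lambda>a b. f a - f b" E]
  by (simp add: graph_laplacian_def sum_subtractf)

lemma sum_mult_graph_laplacian:
  assumes "finite V"
  shows "(\<Sum>a\<in>V. f a * graph_laplacian V E f a) = dirichlet_energy V E f"
proof -
  have "2 * (\<Sum>a\<in>V. f a * graph_laplacian V E f a)
      = (\<Sum>a\<in>V. \<Sum>b\<in>neighbours V E a. f a * (f a - f b))
        + (\<Sum>a\<in>V. \<Sum>b\<in>neighbours V E a. f b * (f b - f a))"
    using sum_neighbours_swap[OF assms, of "\<lambda>a b. f a * (f a - f b)" E]
    by (simp add: graph_laplacian_def sum_distrib_left)
  also have "\<dots> = (\<Sum>a\<in>V. \<Sum>b\<in>neighbours V E a. (f a - f b)\<^sup>2)"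
    by (simp add: power2_eq_square algebra_simps flip: sum.distrib)
  finally show ?thesis by (simp add: dirichlet_energy_def)
qed

lemma dirichlet_energy_nonneg: "0 \<le> dirichlet_energy V E f"
  by (simp add: dirichlet_energy_def sum_nonneg)

lemma dirichlet_energy_mono:
  assumes "finite V" and "E \<subseteq> E'"
  shows "dirichlet_energy V E f \<le> dirichlet_energy V E' f"
  unfolding dirichlet_energy_def
  using assms by (intro divide_right_mono sum_mono sum_mono2) (auto simp: neighbours_def)

lemma dirichlet_energy_eigenfunction:
  assumes "finite V" and "laplacian_eigenfunction V E \<mu> f"
  shows "dirichlet_energy V E f = \<mu> * (\<Sum>a\<in>V. (f a)\<^sup>2)"
  using assms(2) unfolding sum_mult_graph_laplacian[OF assms(1), symmetric] sum_distrib_left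
  by (intro sum.cong) (auto simp: laplacian_eigenfunction_def power2_eq_square)

section \<open>Variational characterization of the algebraic connectivity\<close>

lemma laplacian_mat_carrier: "laplacian_mat vs E \<in> carrier_mat (length vs) (length vs)"
  by (simp add: laplacian_mat_def)

lemma transpose_laplacian_mat: "(laplacian_mat vs E)\<^sup>T = laplacian_mat vs E"
  by (intro eq_matI) (auto simp: laplacian_mat_def insert_commute)

lemma sum_nth_distinct:
  assumes "distinct vs"
  shows "(\<Sum>i<length vs. h (vs ! i)) = (\<Sum>a\<in>set vs. h a)"
  by (rule sum.reindex_bij_betw[OF bij_betw_nth[OF assms refl refl]])

definition values_vec :: "'a list \<Rightarrow> ('a \<Rightarrow> real) \<Rightarrow> real vec" where
  "values_vec vs f = vec (length vs) (\<lambda>i. f (vs ! i))"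

lemma values_vec_carrier: "values_vec vs f \<in> carrier_vec (length vs)"
  by (simp add: values_vec_def)

lemma scalar_prod_values_vec:
  assumes "distinct vs"
  shows "values_vec vs f \<bullet> values_vec vs g = (\<Sum>a\<in>set vs. f a * g a)"
  using sum_nth_distinct[OF assms, of "\<lambda>a. f a * g a"]
  by (simp add: scalar_prod_def values_vec_def lessThan_atLeast0)

lemma values_vec_eq_0_iff:
  "values_vec vs f = 0\<^sub>v (length vs) \<longleftrightarrow> (\<forall>a\<in>set vs. f a = 0)"
  by (auto simp: vec_eq_iff values_vec_def all_set_conv_all_nth)

lemma values_vec_eq_iff: "values_vec vs f = values_vec vs g \<longleftrightarrow> (\<forall>a\<in>set vs. f a = g a)"
  by (auto simp: vec_eq_iff values_vec_def all_set_conv_all_nth)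

lemma smult_values_vec: "c \<cdot>\<^sub>v values_vec vs f = values_vec vs (\<lambda>a. c * f a)"
  by (intro eq_vecI) (auto simp: values_vec_def)

lemma values_vec_surj:
  assumes "distinct vs" and "x \<in> carrier_vec (length vs)"
  obtains f where "x = values_vec vs f"
proof
  have "inv_into {..<length vs} ((!) vs) (vs ! i) = i" if "i < length vs" for i
    using assms(1) that by (intro inv_into_f_f) (auto simp: inj_on_nth)
  then show "x = values_vec vs (\<lambda>a. x $ inv_into {..<length vs} ((!) vs) a)"
    using assms(2) by (intro eq_vecI) (auto simp: values_vec_def)
qed

lemma laplacian_mat_mult_values_vec:
  assumes G: "simple_graph V E" and vs: "distinct vs" "set vs = V"
  shows "laplacian_mat vs E *\<^sub>v values_vec vs f = values_vec vs (graph_laplacian V E f)"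
proof (intro eq_vecI)
  fix i assume "i < dim_vec (values_vec vs (graph_laplacian V E f))"
  then have i: "i < length vs" by (simp add: values_vec_def)
  define a where "a = vs ! i"
  define row where
    "row b = (if b = a then real (vertex_degree E a) else 0) - (if {a, b} \<in> E then 1 else 0)" for b
  have a: "a \<in> V" and fin: "finite V" using i vs by (auto simp: a_def)
  have "laplacian_mat vs E $$ (i, j) = row (vs ! j)" if "j < length vs" for j
    using that i vs(1) simple_graph_no_loop[OF G, of "vs ! j" "vs ! j"]
    by (auto simp: laplacian_mat_def row_def a_def nth_eq_iff_index_eq)
  then have "(laplacian_mat vs E *\<^sub>v values_vec vs f) $ i
      = (\<Sum>j<length vs. row (vs ! j) * f (vs ! j))"
    using i laplacian_mat_carrier[of vs E]
    by (simp add: scalar_prod_def values_vec_def lessThan_atLeast0)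
  also have "\<dots> = (\<Sum>b\<in>V. row b * f b)"
    using sum_nth_distinct[OF vs(1), of "\<lambda>b. row b * f b"] vs(2) by simp
  also have "\<dots> = (\<Sum>b\<in>V. (if b = a then real (vertex_degree E a) * f b else 0)
      - (if {a, b} \<in> E then f b else 0))"
    by (intro sum.cong) (auto simp: row_def left_diff_distrib)
  also have "\<dots> = real (card (neighbours V E a)) * f a - (\<Sum>b\<in>neighbours V E a. f b)"
    using fin a
    by (simp add: sum_subtractf sum.inter_filter neighbours_def
        vertex_degree_eq_card_neighbours[OF G])
  also have "\<dots> = graph_laplacian V E f a"
    by (simp add: graph_laplacian_def sum_subtractf)
  finally show "(laplacian_mat vs E *\<^sub>v values_vec vs f) $ i
      = values_vec vs (graph_laplacian V E f) $ i"
    using i by (simp add: values_vec_def a_def)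
qed (simp add: laplacian_mat_def values_vec_def)

lemma eigenvector_laplacian_mat_ones:
  assumes "simple_graph V E" and "distinct vs" "set vs = V" and "vs \<noteq> []"
  shows "eigenvector (laplacian_mat vs E) (values_vec vs (\<lambda>_. 1)) 0"
proof -
  define ones :: "real vec" where "ones = values_vec vs (\<lambda>_. 1)"
  have "ones \<in> carrier_vec (length vs)"
    by (simp add: ones_def values_vec_carrier)
  moreover have "ones \<noteq> 0\<^sub>v (length vs)"
    using \<open>vs \<noteq> []\<close> by (simp add: ones_def values_vec_eq_0_iff)
  moreover have "laplacian_mat vs E *\<^sub>v ones = 0 \<cdot>\<^sub>v ones"
    unfolding ones_def laplacian_mat_mult_values_vec[OF assms(1-3)]
    by (intro eq_vecI) (simp_all add: graph_laplacian_def values_vec_def)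
  ultimately show ?thesis
    by (simp add: eigenvector_def laplacian_mat_def flip: ones_def)
qed

lemma laplacian_mat_eigenvalue_nonneg:
  assumes G: "simple_graph V E" and vs: "distinct vs" "set vs = V"
    and "eigenvalue (laplacian_mat vs E) \<mu>"
  shows "0 \<le> \<mu>"
proof -
  obtain x where x: "x \<in> carrier_vec (length vs)" "x \<noteq> 0\<^sub>v (length vs)"
    "laplacian_mat vs E *\<^sub>v x = \<mu> \<cdot>\<^sub>v x"
    using assms(4) laplacian_mat_carrier[of vs E] unfolding eigenvalue_def eigenvector_def by auto
  obtain f where f: "x = values_vec vs f"
    using values_vec_surj[OF vs(1) x(1)] .
  have "\<mu> * (x \<bullet> x) = x \<bullet> (laplacian_mat vs E *\<^sub>v x)"
    using x by simp
  also have "\<dots> = dirichlet_energy V E f"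
    using vs by (simp add: f laplacian_mat_mult_values_vec[OF G vs] scalar_prod_values_vec
        sum_mult_graph_laplacian[OF simple_graph_finite[OF G]])
  finally have "0 \<le> \<mu> * (x \<bullet> x)"
    using dirichlet_energy_nonneg by simp
  moreover have "x \<bullet> x > 0"
    using conjugate_square_greater_0_vec[OF x(1)] x(2) by simp
  ultimately show ?thesis by (simp add: zero_le_mult_iff)
qed

lemma proots_prod_list_linear:
  fixes es :: "'a::idom list"
  shows "proots (\<Prod>x\<leftarrow>es. [:- x, 1:]) = mset es"
proof (induction es)
  case (Cons e es)
  have "(\<Prod>x\<leftarrow>es. [:- x, 1:]) \<noteq> 0" by (auto simp: prod_list_zero_iff)
  then have "proots (\<Prod>x\<leftarrow>e # es. [:- x, 1:]) = proots [:- e, 1:] + proots (\<Prod>x\<leftarrow>es. [:- x, 1:])"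
    by (simp add: proots_mult del: mult_pCons_left)
  then show ?case by (simp add: Cons.IH)
qed simp

lemma laplacian_char_poly_factorization:
  assumes G: "simple_graph V E" and card: "2 \<le> card V" and vs: "distinct vs" "set vs = V"
  obtains es where
    "char_poly (laplacian_mat vs E) = (\<Prod>x\<leftarrow>0 # algebraic_connectivity V E # es. [:- x, 1:])"
    "sorted (algebraic_connectivity V E # es)"
proof -
  let ?L = "laplacian_mat vs E"
  note L = laplacian_mat_carrier[of vs E]
  have length_vs: "2 \<le> length vs" using card vs distinct_card by fastforce
  obtain es where es: "char_poly ?L = (\<Prod>x\<leftarrow>es. [:- x, 1:])" "length es = length vs" "sorted es"
    using real_symmetric_char_poly_splits[OF L transpose_laplacian_mat] by blast
  have eigenvalue_iff: "eigenvalue ?L e \<longleftrightarrow> e \<in> set es" for e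
    by (auto simp: eigenvalue_root_char_poly[OF L] es(1) poly_prod_list o_def prod_list_zero_iff)
  have "0 \<in> set es"
    using eigenvector_laplacian_mat_ones[OF G vs] length_vs eigenvalue_iff
    unfolding eigenvalue_def by fastforce
  moreover have "\<forall>e\<in>set es. 0 \<le> e"
    using laplacian_mat_eigenvalue_nonneg[OF G vs] eigenvalue_iff by blast
  moreover obtain e \<mu> es' where es_split: "es = e # \<mu> # es'"
    using es(2) length_vs by (metis Suc_le_length_iff numeral_2_eq_2)
  ultimately have e_eq_0: "e = 0" using es(3) by force
  have "proots (char_poly ?L) = mset es"
    unfolding es(1) by (rule proots_prod_list_linear)
  then have "algebraic_connectivity V E = sort es ! 1"
    by (simp add: algebraic_connectivity_def laplacian_char_poly_eq[OF vs])
  then have "algebraic_connectivity V E = \<mu>"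
    unfolding sorted_sort_id[OF es(3)] by (simp add: es_split)
  then show ?thesis
    using that[of es'] es(1,3) unfolding es_split e_eq_0 by simp
qed

lemma
  assumes G: "simple_graph V E" and card: "2 \<le> card V"
  shows algebraic_connectivity_eigenfunction:
      "\<exists>f. laplacian_eigenfunction V E (algebraic_connectivity V E) f \<and> sum f V = 0"
    and algebraic_connectivity_le_dirichlet_energy:
      "\<And>f. sum f V = 0 \<Longrightarrow>
        algebraic_connectivity V E * (\<Sum>a\<in>V. (f a)\<^sup>2) \<le> dirichlet_energy V E f"
proof -
  let ?\<alpha> = "algebraic_connectivity V E"
  obtain vs where vs: "distinct vs" "set vs = V"
    using finite_distinct_list[OF simple_graph_finite[OF G]] by auto
  let ?L = "laplacian_mat vs E" and ?n = "length vs" and ?ones = "values_vec vs (\<lambda>_. 1)"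
  obtain es where es: "char_poly ?L = (\<Prod>x\<leftarrow>0 # ?\<alpha> # es. [:- x, 1:])" "sorted (?\<alpha> # es)"
    using laplacian_char_poly_factorization[OF G card vs] .
  have "vs \<noteq> []" using card vs by auto
  then have "eigenvector ?L ?ones 0"
    by (rule eigenvector_laplacian_mat_ones[OF G vs])
  then have ones: "?ones \<in> carrier_vec ?n" "?ones \<noteq> 0\<^sub>v ?n" "?L *\<^sub>v ?ones = 0 \<cdot>\<^sub>v ?ones"
    unfolding eigenvector_def carrier_matD(1)[OF laplacian_mat_carrier] by blast+
  have orthogonal: "values_vec vs f \<bullet> ?ones = sum f V" for f :: "'a \<Rightarrow> real"
    by (simp add: scalar_prod_values_vec vs)
  note L = laplacian_mat_carrier transpose_laplacian_mat
  obtain x where x: "x \<in> carrier_vec ?n" "x \<noteq> 0\<^sub>v ?n" "x \<bullet> ?ones = 0" "?L *\<^sub>v x = ?\<alpha> \<cdot>\<^sub>v x"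
    using symmetric_mat_orthogonal_eigenvector[OF L ones es(1)] .
  obtain f where f: "x = values_vec vs f" using values_vec_surj[OF vs(1) x(1)] .
  have "\<forall>a\<in>V. graph_laplacian V E f a = ?\<alpha> * f a"
    using x(4)
    by (simp only: f laplacian_mat_mult_values_vec[OF G vs] smult_values_vec
        values_vec_eq_iff vs(2))
  moreover have "\<exists>a\<in>V. f a \<noteq> 0"
    using x(2) by (auto simp only: f values_vec_eq_0_iff vs(2))
  ultimately have "laplacian_eigenfunction V E ?\<alpha> f"
    by (simp add: laplacian_eigenfunction_def)
  then show "\<exists>f. laplacian_eigenfunction V E ?\<alpha> f \<and> sum f V = 0"
    using x(3) unfolding f orthogonal by blast
  show "?\<alpha> * (\<Sum>a\<in>V. (f a)\<^sup>2) \<le> dirichlet_energy V E f" if "sum f V = 0" for f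
    using symmetric_mat_Rayleigh_le[OF L ones es(1), of ?\<alpha> "values_vec vs f"] es(2) that
    by (simp add: orthogonal laplacian_mat_mult_values_vec[OF G vs]
        scalar_prod_values_vec[OF vs(1)] vs(2) power2_eq_square
        sum_mult_graph_laplacian[OF simple_graph_finite[OF G]] values_vec_carrier)
qed

lemma two_le_card_if_sum_eq_0:
  fixes f :: "'a \<Rightarrow> 'b::comm_monoid_add"
  assumes "finite V" "a \<in> V" "f a \<noteq> 0" "sum f V = 0"
  shows "2 \<le> card V"
proof (rule ccontr)
  assume "\<not> 2 \<le> card V"
  then have "card V = 1" using assms(1,2) card_gt_0_iff[of V] by fastforce
  then have "V = {a}" using assms(2) by (auto simp: card_1_singleton_iff)
  then show False using assms by simp
qed

lemma algebraic_connectivity_le: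
  assumes G: "simple_graph V E" and a: "a \<in> V" "f a \<noteq> 0" and sum: "sum f V = 0"
    and energy_le: "dirichlet_energy V E f \<le> \<mu> * (\<Sum>a\<in>V. (f a)\<^sup>2)"
  shows "algebraic_connectivity V E \<le> \<mu>"
proof -
  have fin: "finite V" using G by (rule simple_graph_finite)
  have "algebraic_connectivity V E * (\<Sum>a\<in>V. (f a)\<^sup>2) \<le> \<mu> * (\<Sum>a\<in>V. (f a)\<^sup>2)"
    using algebraic_connectivity_le_dirichlet_energy[OF G
        two_le_card_if_sum_eq_0[OF fin a sum] sum] energy_le
    by linarith
  moreover have "(\<Sum>a\<in>V. (f a)\<^sup>2) > 0"
    using fin a by (intro sum_pos2[of _ a]) auto
  ultimately show ?thesis by simp
qed

lemma algebraic_connectivity_less: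
  assumes G: "simple_graph V E" and a: "a \<in> V" "f a \<noteq> 0" and sum: "sum f V = 0"
    and energy_less: "dirichlet_energy V E f < \<mu> * (\<Sum>a\<in>V. (f a)\<^sup>2)"
  shows "algebraic_connectivity V E < \<mu>"
proof -
  have "algebraic_connectivity V E * (\<Sum>a\<in>V. (f a)\<^sup>2) < \<mu> * (\<Sum>a\<in>V. (f a)\<^sup>2)"
    using algebraic_connectivity_le_dirichlet_energy[OF G
        two_le_card_if_sum_eq_0[OF simple_graph_finite[OF G] a sum] sum] energy_less
    by linarith
  then show ?thesis
    by (rule mult_right_less_imp_less) (simp add: sum_nonneg)
qed

lemma algebraic_connectivity_le_if_dirichlet_energy_le:
  assumes G: "simple_graph V E" and ev: "laplacian_eigenfunction V E' \<mu> f" and sum: "sum f V = 0"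
    and energy_le: "dirichlet_energy V E f \<le> dirichlet_energy V E' f"
  shows "algebraic_connectivity V E \<le> \<mu>"
proof -
  obtain a where "a \<in> V" "f a \<noteq> 0" using ev by (auto simp: laplacian_eigenfunction_def)
  then show ?thesis
    using energy_le dirichlet_energy_eigenfunction[OF simple_graph_finite[OF G] ev]
    by (intro algebraic_connectivity_le[OF G _ _ sum]) auto
qed

lemma algebraic_connectivity_mono:
  assumes G': "simple_graph V E'" and sub: "E \<subseteq> E'" and card: "2 \<le> card V"
  shows "algebraic_connectivity V E \<le> algebraic_connectivity V E'"
proof -
  have fin: "finite V" and G: "simple_graph V E" using G' sub by (auto simp: simple_graph_def)
  obtain f where "laplacian_eigenfunction V E' (algebraic_connectivity V E') f" "sum f V = 0"
    using algebraic_connectivity_eigenfunction[OF G' card] by blast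
  then show ?thesis
    by (rule algebraic_connectivity_le_if_dirichlet_energy_le[OF G])
      (rule dirichlet_energy_mono[OF fin sub])
qed

lemma algebraic_connectivity_union_le:
  assumes G: "simple_graph V (E \<union> F)"
    and ev: "laplacian_eigenfunction V E (algebraic_connectivity V E) f" and sum: "sum f V = 0"
    and const: "\<And>a b. {a, b} \<in> F \<Longrightarrow> f a = f b"
  shows "algebraic_connectivity V (E \<union> F) \<le> algebraic_connectivity V E"
proof -
  have "(\<Sum>b\<in>neighbours V (E \<union> F) a. (f a - f b)\<^sup>2) = (\<Sum>b\<in>neighbours V E a. (f a - f b)\<^sup>2)" for a
    using simple_graph_finite[OF G] const
    by (intro sum.mono_neutral_right) (auto simp: neighbours_def)
  then have "dirichlet_energy V (E \<union> F) f = dirichlet_energy V E f"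
    by (simp add: dirichlet_energy_def)
  then show ?thesis
    by (intro algebraic_connectivity_le_if_dirichlet_energy_le[OF G ev sum]) simp
qed

section \<open>Cut vertices and pendant vertices\<close>

lemma graph_laplacian_if_constant_off_vertex:
  assumes fin: "finite V" and v: "v \<in> V" "f v = 0"
    and const: "\<And>b. b \<in> neighbours V E a \<Longrightarrow> b \<noteq> v \<Longrightarrow> f b = f a"
  shows "graph_laplacian V E f a = (if {v, a} \<in> E then f a else 0)"
proof -
  have "graph_laplacian V E f a = (\<Sum>b\<in>neighbours V E a. if b = v then f a else 0)"
    unfolding graph_laplacian_def using const v(2) by (intro sum.cong) auto
  also have "\<dots> = (if v \<in> neighbours V E a then f a else 0)"
    using fin by (simp add: finite_neighbours)
  finally show ?thesis using v(1) by (simp add: neighbours_def insert_commute)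
qed

lemma algebraic_connectivity_less_1_cut_vertex:
  assumes G: "simple_graph V E" and v: "v \<in> V"
    and parts: "V - {v} = A \<union> B" "A \<inter> B = {}" "A \<noteq> {}" "B \<noteq> {}"
    and no_edge: "\<And>a b. a \<in> A \<Longrightarrow> b \<in> B \<Longrightarrow> {a, b} \<notin> E"
    and w: "w \<in> V - {v}" "{v, w} \<notin> E"
  shows "algebraic_connectivity V E < 1"
proof -
  define f where
    "f a = (if a \<in> A then real (card B) else if a \<in> B then - real (card A) else 0)" for a
  have fin: "finite V" "finite A" "finite B"
    using simple_graph_finite[OF G] parts(1) by (auto dest: arg_cong[of _ _ finite])
  have f_v: "f v = 0" using parts(1) by (auto simp: f_def)
  have f_nonzero: "f a \<noteq> 0" if "a \<in> V - {v}" for a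
    using that parts fin by (auto simp: f_def)
  have "sum f (V - {v}) = sum f A + sum f B"
    unfolding parts(1) using fin parts(2) by (intro sum.union_disjoint) auto
  also have "\<dots> = (\<Sum>a\<in>A. real (card B)) + (\<Sum>b\<in>B. - real (card A))"
    using parts(2) by (intro arg_cong2[of _ _ _ _ "(+)"] sum.cong) (auto simp: f_def)
  finally have sum: "sum f V = 0"
    using sum.remove[OF fin(1) v, of f] f_v by simp
  have laplacian: "graph_laplacian V E f a = (if {v, a} \<in> E then f a else 0)"
    if "a \<in> V - {v}" for a
    using that parts(1,2) no_edge[of a] no_edge[of _ a]
    by (intro graph_laplacian_if_constant_off_vertex[where f = f, OF fin(1) v f_v])
      (auto simp: neighbours_def f_def insert_commute)
  have "(\<Sum>a\<in>V. f a * graph_laplacian V E f a) < (\<Sum>a\<in>V. (f a)\<^sup>2)"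
  proof (rule sum_strict_mono_ex1)
    show "\<forall>a\<in>V. f a * graph_laplacian V E f a \<le> (f a)\<^sup>2"
    proof
      fix a assume "a \<in> V"
      then show "f a * graph_laplacian V E f a \<le> (f a)\<^sup>2"
        using f_v laplacian[of a] by (cases "a = v") (simp_all add: power2_eq_square)
    qed
    show "\<exists>a\<in>V. f a * graph_laplacian V E f a < (f a)\<^sup>2"
      using w f_nonzero[OF w(1)] by (intro bexI[of _ w]) (auto simp: laplacian)
  qed (rule fin(1))
  then show ?thesis
    using w f_nonzero by (intro algebraic_connectivity_less[OF G _ _ sum, of w])
      (auto simp: sum_mult_graph_laplacian[OF fin(1)])
qed

lemma neighbours_pendant:
  assumes G: "simple_graph V E" and "pendant E u" "{u, v} \<in> E"
  shows "neighbours V E u = {v}"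
proof -
  have "card (neighbours V E u) = 1"
    using assms by (simp add: pendant_def vertex_degree_eq_card_neighbours[OF G])
  moreover have "v \<in> neighbours V E u" using assms by (auto simp: simple_graph_def neighbours_def)
  ultimately show ?thesis by (metis card_1_singletonE singletonD)
qed

lemma obtain_non_neighbour:
  assumes G: "simple_graph V E" and v: "v \<in> V" and "vertex_degree E v \<noteq> card V - 1"
  obtains w where "w \<in> V - {v}" "{v, w} \<notin> E"
proof -
  have "card (neighbours V E v) \<noteq> card (V - {v})"
    using assms(3) v simple_graph_finite[OF G]
    by (simp flip: vertex_degree_eq_card_neighbours[OF G])
  moreover have "neighbours V E v \<subseteq> V - {v}"
    using simple_graph_no_loop[OF G, of v v] by (auto simp: neighbours_def)
  ultimately obtain w where "w \<in> V - {v}" "w \<notin> neighbours V E v"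
    by (metis subsetI subset_antisym)
  then show ?thesis using that[of w] by (simp add: neighbours_def)
qed

lemma algebraic_connectivity_less_1_pendant:
  assumes G: "simple_graph V E" and v: "v \<in> V" "vertex_degree E v \<noteq> card V - 1"
    and u: "pendant E u" "{u, v} \<in> E"
  shows "algebraic_connectivity V E < 1"
proof -
  obtain w where w: "w \<in> V - {v}" "{v, w} \<notin> E" using obtain_non_neighbour[OF G v] .
  have "u \<in> V" "u \<noteq> v" using G u(2) by (auto simp: simple_graph_def)
  moreover have "w \<noteq> u" using w(2) u(2) by (auto simp: insert_commute)
  moreover have "{a, b} \<notin> E" if "a \<in> {u}" "b \<in> V - {u, v}" for a b
    using neighbours_pendant[OF G u] that by (auto simp: neighbours_def)
  ultimately show ?thesis
    using w
    by (intro algebraic_connectivity_less_1_cut_vertex[OF G v(1), of "{u}" "V - {u, v}" w]) auto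
qed

lemma laplacian_eigenfunction_pendant:
  assumes G: "simple_graph V E" and u: "pendant E u" "{u, v} \<in> E"
    and ev: "laplacian_eigenfunction V E \<mu> f"
  shows "(1 - \<mu>) * f u = f v"
proof -
  have "u \<in> V" using G u(2) by (auto simp: simple_graph_def)
  then have "graph_laplacian V E f u = \<mu> * f u"
    using ev by (simp add: laplacian_eigenfunction_def)
  then have "f u - f v = \<mu> * f u"
    by (simp add: graph_laplacian_def neighbours_pendant[OF G u])
  then show ?thesis by (simp add: algebra_simps)
qed

lemma algebraic_connectivity_add_pendant_edges_le:
  assumes G: "simple_graph V E" and G': "simple_graph V (E \<union> F)" and card: "2 \<le> card V"
    and not_1: "algebraic_connectivity V E \<noteq> 1"
    and pendants: "\<forall>u\<in>S. pendant E u \<and> {u, v} \<in> E" and F: "\<Union>F \<subseteq> S"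
  shows "algebraic_connectivity V (E \<union> F) \<le> algebraic_connectivity V E"
proof -
  obtain f where ev: "laplacian_eigenfunction V E (algebraic_connectivity V E) f"
    and sum: "sum f V = 0"
    using algebraic_connectivity_eigenfunction[OF G card] by blast
  have "f a = f b" if "{a, b} \<in> F" for a b
  proof -
    have "a \<in> S" "b \<in> S" using F that by auto
    then have "(1 - algebraic_connectivity V E) * f a = (1 - algebraic_connectivity V E) * f b"
      using pendants laplacian_eigenfunction_pendant[OF G _ _ ev] by metis
    then show ?thesis using not_1 by simp
  qed
  then show ?thesis by (rule algebraic_connectivity_union_le[OF G' ev sum])
qed

section \<open>Token graphs\<close>

lemma token_edges_doubleton_iff:
  assumes "simple_graph V E"
  shows "{A, B} \<in> token_edges k V E \<longleftrightarrow>
    A \<in> token_verts k V \<and> B \<in> token_verts k V \<and> sym_diff A B \<in> E"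
proof -
  have "(\<exists>a b. e = {a, b} \<and> {a, b} \<in> E) \<longleftrightarrow> e \<in> E" for e
    using assms unfolding simple_graph_def card_2_iff by metis
  then show ?thesis
    by (auto simp: token_edges_def doubleton_eq_iff Un_commute)
qed

lemma token_vertsD:
  assumes "A \<in> token_verts k V"
  shows "A \<subseteq> V" and "card A = k" and "finite V \<Longrightarrow> finite A"
  using assms by (auto simp: token_verts_def intro: finite_subset)

lemma token_move_in_token_verts:
  assumes "finite V" and A: "A \<in> token_verts k V" and "a \<in> A" "b \<in> V - A"
  shows "insert b (A - {a}) \<in> token_verts k V"
  using assms token_vertsD[OF A] card_Suc_Diff1[of A a] by (auto simp: token_verts_def)

lemma singleton_diffs_if_card_sym_diff_eq_2:
  assumes "finite A" "finite B" and "card A = card B" and "card (sym_diff A B) = 2"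
  obtains a b where "A - B = {a}" "B - A = {b}"
proof -
  have "card (sym_diff A B) = card (A - B) + card (B - A)"
    using assms(1,2) by (intro card_Un_disjoint) auto
  moreover have "card (A - B) = card (B - A)"
    using card_Int_Diff[OF assms(1), of B] card_Int_Diff[OF assms(2), of A] assms(3)
    by (simp add: Int_commute)
  ultimately have "card (A - B) = 1" "card (B - A) = 1" using assms(4) by auto
  then show ?thesis using that by (auto simp: card_1_singleton_iff)
qed

lemma neighbours_token:
  assumes G: "simple_graph V E" and A: "A \<in> token_verts k V"
  shows "neighbours (token_verts k V) (token_edges k V E) A
    = (\<lambda>(a, b). insert b (A - {a})) ` (SIGMA a:A. neighbours (V - A) E a)"
proof (intro equalityI subsetI)
  note finV = simple_graph_finite[OF G]
  fix B assume "B \<in> neighbours (token_verts k V) (token_edges k V E) A"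
  then have B: "B \<in> token_verts k V" and edge: "sym_diff A B \<in> E"
    by (auto simp: neighbours_def token_edges_doubleton_iff[OF G])
  have "card (sym_diff A B) = 2" using G edge by (auto simp: simple_graph_def)
  then obtain a b where ab: "A - B = {a}" "B - A = {b}"
    using singleton_diffs_if_card_sym_diff_eq_2 token_vertsD[OF A] token_vertsD[OF B] finV by metis
  then have "b \<in> neighbours (V - A) E a"
    using edge token_vertsD(1)[OF B] by (auto simp: neighbours_def insert_commute)
  moreover have "B = insert b (A - {a})" "a \<in> A" using ab by blast+
  ultimately show "B \<in> (\<lambda>(a, b). insert b (A - {a})) ` (SIGMA a:A. neighbours (V - A) E a)"
    by force
next
  fix B assume "B \<in> (\<lambda>(a, b). insert b (A - {a})) ` (SIGMA a:A. neighbours (V - A) E a)"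
  then obtain a b where a: "a \<in> A" and b: "b \<in> V - A" "{a, b} \<in> E" and B: "B = insert b (A - {a})"
    by (auto simp: neighbours_def)
  have "sym_diff A B = {a, b}" using a b B by blast
  then show "B \<in> neighbours (token_verts k V) (token_edges k V E) A"
    using token_move_in_token_verts[OF simple_graph_finite[OF G] A a b(1)] A B b(2)
    by (simp add: neighbours_def token_edges_doubleton_iff[OF G])
qed

lemma inj_on_token_move:
  assumes "A \<inter> C = {}"
  shows "inj_on (\<lambda>(a, b). insert b (A - {a})) (A \<times> C)"
proof (rule inj_onI, clarify)
  fix a b c d
  assume "a \<in> A" "b \<in> C" "c \<in> A" "d \<in> C" and eq: "insert b (A - {a}) = insert d (A - {c})"
  then have "A - insert b (A - {a}) = {a}" "insert b (A - {a}) - A = {b}"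
    "A - insert d (A - {c}) = {c}" "insert d (A - {c}) - A = {d}"
    using assms by auto
  then show "a = c \<and> b = d" using eq by (metis singleton_inject)
qed

lemma graph_laplacian_token:
  assumes G: "simple_graph V E" and A: "A \<in> token_verts k V"
  shows "graph_laplacian (token_verts k V) (token_edges k V E) (sum f) A
    = sum (graph_laplacian V E f) A"
proof -
  have finV: "finite V" and finA: "finite A" and AV: "A \<subseteq> V"
    using simple_graph_finite[OF G] token_vertsD[OF A] by auto
  let ?moves = "SIGMA a:A. neighbours (V - A) E a" and ?move = "\<lambda>(a, b). insert b (A - {a})"
  have inj: "inj_on ?move ?moves"
    by (rule inj_on_subset[OF inj_on_token_move[of A "V - A"]]) (auto simp: neighbours_def)
  have split: "graph_laplacian V E f a
      = graph_laplacian A E f a + (\<Sum>b\<in>neighbours (V - A) E a. f a - f b)" for a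
  proof -
    have "neighbours V E a = neighbours A E a \<union> neighbours (V - A) E a"
      using AV by (auto simp: neighbours_def)
    then show ?thesis
      unfolding graph_laplacian_def using finV finA
      by (auto simp: neighbours_def intro!: sum.union_disjoint)
  qed
  have "graph_laplacian (token_verts k V) (token_edges k V E) (sum f) A
      = (\<Sum>p\<in>?moves. sum f A - sum f (?move p))"
    unfolding graph_laplacian_def neighbours_token[OF G A] sum.reindex[OF inj] by (simp add: o_def)
  also have "\<dots> = (\<Sum>(a, b)\<in>?moves. f a - f b)"
    using finA by (intro sum.cong) (auto simp: sum_diff1 neighbours_def)
  also have "\<dots> = (\<Sum>a\<in>A. \<Sum>b\<in>neighbours (V - A) E a. f a - f b)"
    using finV finA by (intro sum.Sigma[symmetric]) (auto simp: finite_neighbours)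
  also have "\<dots> = sum (graph_laplacian V E f) A"
    using sum_graph_laplacian[OF finA, of E f] by (simp add: split sum.distrib)
  finally show ?thesis .
qed

lemma card_token_verts_containing:
  assumes "finite V" "a \<in> V" "1 \<le> k"
  shows "card {A \<in> token_verts k V. a \<in> A} = (card V - 1) choose (k - 1)"
proof -
  have "bij_betw (insert a) {B. B \<subseteq> V - {a} \<and> card B = k - 1} {A \<in> token_verts k V. a \<in> A}"
  proof (rule bij_betwI[where g = "\<lambda>A. A - {a}"])
    show "insert a \<in> {B. B \<subseteq> V - {a} \<and> card B = k - 1} \<rightarrow> {A \<in> token_verts k V. a \<in> A}"
    proof
      fix B assume B: "B \<in> {B. B \<subseteq> V - {a} \<and> card B = k - 1}"
      then have "finite B" "a \<notin> B" using assms(1) by (auto intro: finite_subset)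
      then show "insert a B \<in> {A \<in> token_verts k V. a \<in> A}"
        using B assms by (auto simp: token_verts_def)
    qed
  qed (auto simp: token_verts_def)
  then show ?thesis
    using assms n_subsets[of "V - {a}" "k - 1"] by (simp flip: bij_betw_same_card)
qed

lemma sum_token_verts:
  fixes f :: "'a \<Rightarrow> 'b::comm_semiring_1"
  assumes "finite V" "1 \<le> k"
  shows "(\<Sum>A\<in>token_verts k V. sum f A) = of_nat ((card V - 1) choose (k - 1)) * sum f V"
proof -
  have fin: "finite (token_verts k V)" using assms(1) by (simp add: token_verts_def)
  have "(\<Sum>A\<in>token_verts k V. sum f A) = (\<Sum>A\<in>token_verts k V. \<Sum>a\<in>{a\<in>V. a \<in> A}. f a)"
    by (intro sum.cong) (auto simp: token_verts_def)
  also have "\<dots> = (\<Sum>a\<in>V. \<Sum>A\<in>{A \<in> token_verts k V. a \<in> A}. f a)"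
    by (rule sum.swap_restrict[OF fin assms(1)])
  also have "\<dots> = (\<Sum>a\<in>V. of_nat ((card V - 1) choose (k - 1)) * f a)"
    using card_token_verts_containing[OF assms(1) _ assms(2)] by (intro sum.cong) auto
  finally show ?thesis by (simp add: sum_distrib_left)
qed

lemma eq_0_if_all_token_sums_eq_0:
  fixes f :: "'a \<Rightarrow> 'b::{ring_char_0, ring_1_no_zero_divisors}"
  assumes fin: "finite V" and k: "1 \<le> k" "k \<le> card V - 1"
    and zero: "\<And>A. A \<in> token_verts k V \<Longrightarrow> sum f A = 0" and a: "a \<in> V"
  shows "f a = 0"
proof -
  have "f b = f a" if b: "b \<in> V" "b \<noteq> a" for b
  proof -
    have "k - 1 \<le> card (V - {a, b})" using fin k a b by (simp add: card_Diff_subset)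
    then obtain C where C: "C \<subseteq> V - {a, b}" "card C = k - 1"
      by (meson obtain_subset_with_card_n)
    have "finite C" "a \<notin> C" "b \<notin> C" using C fin by (auto intro: finite_subset)
    moreover from this have "sum f (insert a C) = 0" "sum f (insert b C) = 0"
      using C a b k by (intro zero; auto simp: token_verts_def)+
    ultimately show ?thesis by (simp add: add_eq_0_iff2)
  qed
  then have const: "f b = f a" if "b \<in> V" for b using that by blast
  obtain A where A: "A \<subseteq> V" "card A = k"
    using k by (metis obtain_subset_with_card_n diff_le_self le_trans)
  then have "of_nat k * f a = sum f A"
    using const by (simp add: subset_iff)
  also have "\<dots> = 0" using zero A by (simp add: token_verts_def)
  finally show ?thesis using k by simp
qed

lemma laplacian_eigenfunction_token:
  assumes G: "simple_graph V E" and k: "1 \<le> k" "k \<le> card V - 1"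
    and ev: "laplacian_eigenfunction V E \<mu> f"
  shows "laplacian_eigenfunction (token_verts k V) (token_edges k V E) \<mu> (sum f)"
proof -
  have "\<exists>A\<in>token_verts k V. sum f A \<noteq> 0"
    using eq_0_if_all_token_sums_eq_0[OF simple_graph_finite[OF G] k, of f] ev
    by (auto simp: laplacian_eigenfunction_def)
  moreover have "graph_laplacian (token_verts k V) (token_edges k V E) (sum f) A = \<mu> * sum f A"
    if A: "A \<in> token_verts k V" for A
    unfolding graph_laplacian_token[OF G A] sum_distrib_left
    using ev token_vertsD(1)[OF A] by (intro sum.cong) (auto simp: laplacian_eigenfunction_def)
  ultimately show ?thesis by (auto simp: laplacian_eigenfunction_def)
qed

lemma two_le_card_token_verts:
  assumes "finite V" and k: "1 \<le> k" "k \<le> card V - 1"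
  shows "2 \<le> card (token_verts k V)"
proof -
  obtain m where m: "card V = Suc m" using k by (cases "card V") auto
  obtain j where j: "k = Suc j" using k(1) by (cases k) auto
  have "card (token_verts k V) = (m choose j) + (m choose Suc j)"
    using n_subsets[OF assms(1), of k] by (simp add: token_verts_def m j)
  moreover have "0 < m choose j" "0 < m choose Suc j"
    using k m j by simp_all
  ultimately show ?thesis by linarith
qed

lemma algebraic_connectivity_token_le:
  assumes G: "simple_graph V E" and k: "1 \<le> k" "k \<le> card V - 1"
  shows "algebraic_connectivity (token_verts k V) (token_edges k V E) \<le> algebraic_connectivity V E"
proof -
  let ?T = "token_verts k V" and ?\<alpha> = "algebraic_connectivity V E"
  obtain f where ev: "laplacian_eigenfunction V E ?\<alpha> f" and sum: "sum f V = 0"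
    using algebraic_connectivity_eigenfunction[OF G] k by fastforce
  have ev_T: "laplacian_eigenfunction ?T (token_edges k V E) ?\<alpha> (sum f)"
    by (rule laplacian_eigenfunction_token[OF G k ev])
  have "sum (sum f) ?T = 0"
    using sum_token_verts[OF simple_graph_finite[OF G] k(1), of f] sum by simp
  then show ?thesis
    by (rule algebraic_connectivity_le_if_dirichlet_energy_le[OF simple_graph_token[OF G] ev_T])
      (rule order_refl)
qed

lemma algebraic_connectivity_token_mono:
  assumes "simple_graph V E'" "E \<subseteq> E'" and "1 \<le> k" "k \<le> card V - 1"
  shows "algebraic_connectivity (token_verts k V) (token_edges k V E)
    \<le> algebraic_connectivity (token_verts k V) (token_edges k V E')"
proof (rule algebraic_connectivity_mono)
  show "token_edges k V E \<subseteq> token_edges k V E'"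
    using assms(2) unfolding token_edges_def by blast
qed (use assms simple_graph_token simple_graph_finite two_le_card_token_verts in blast)+

theorem theorem3p5:
  fixes V :: "'a set" and E F :: "'a set set" and S :: "'a set" and v :: 'a
    and n k s t :: nat
  assumes "simple_graph V E" and "card V = n"
    and "1 \<le> k" and "k \<le> n - 1"
    and "S \<subseteq> V" and "card S = s" and "2 \<le> s"
    and "v \<in> V" and "vertex_degree E v \<noteq> n - 1"
    and "\<forall>u\<in>S. pendant E u \<and> {u, v} \<in> E"
    and "F \<subseteq> {{x, y} | x y. x \<in> S \<and> y \<in> S \<and> x \<noteq> y}"
    and "card F = t" and "t \<le> s * (s - 1) div 2"
    and "algebraic_connectivity (token_verts k V) (token_edges k V E)
           = algebraic_connectivity V E"
  shows "algebraic_connectivity (token_verts k V) (token_edges k V (E \<union> F))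
           = algebraic_connectivity V (E \<union> F)"
proof (rule antisym)
  have G': "simple_graph V (E \<union> F)"
    using assms(1,5,11) by (fastforce simp: simple_graph_def)
  have k: "1 \<le> k" "k \<le> card V - 1" using assms(2-4) by auto
  show "algebraic_connectivity (token_verts k V) (token_edges k V (E \<union> F))
      \<le> algebraic_connectivity V (E \<union> F)"
    by (rule algebraic_connectivity_token_le[OF G' k])
  obtain u where "u \<in> S" using assms(6,7) by fastforce
  then have "algebraic_connectivity V E < 1"
    using algebraic_connectivity_less_1_pendant[OF assms(1,8)] assms(2,9,10) by blast
  moreover have "\<Union>F \<subseteq> S" using assms(11) by blast
  ultimately have "algebraic_connectivity V (E \<union> F) \<le> algebraic_connectivity V E"
    using algebraic_connectivity_add_pendant_edges_le[OF assms(1) G' _ _ assms(10)] k by simp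
  also have "\<dots> = algebraic_connectivity (token_verts k V) (token_edges k V E)"
    using assms(14) ..
  also have "\<dots> \<le> algebraic_connectivity (token_verts k V) (token_edges k V (E \<union> F))"
    by (rule algebraic_connectivity_token_mono[OF G' _ k]) simp
  finally show "algebraic_connectivity V (E \<union> F)
      \<le> algebraic_connectivity (token_verts k V) (token_edges k V (E \<union> F))" .
qed

end
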